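(* Let $0<a<b$, $\beta>0$, and let $f:[a,b]\to\mathbb{R}$ be a function such that: (1) $f$ is continuous on $[a,b]$; (2) $f$ is $\alpha$-differentiable on $(a,b)$ for some $\alpha\in(0,1)$ (i.e. $\mathscr{D}_M^{\alpha,\beta}f(t)$ exists for every $t\in(a,b)$); (3) $f(a)=f(b)$. Then there exists $c\in(a,b)$ such that $\mathscr{D}_M^{\alpha,\beta}f(c)=0$.
   Context: For $\beta>0$, $\mathbb{E}_\beta(x)=\sum_{k=0}^\infty \frac{x^k}{\Gamma(\beta k+1)}$ is the one-parameter Mittag-Leffler function. For $0<\alpha<1$, $\beta>0$, $t>0$ and a real-valued function $f$ defined in a neighbourhood of $t$, the local $M$-derivative of order $\alpha$ of $f$ at $t$ is $$\mathscr{D}_M^{\alpha,\beta}f(t)=\lim_{\varepsilon\to 0}\frac{f\big(t\,\mathbb{E}_\beta(\varepsilon t^{-\alpha})\big)-f(t)}{\varepsilon}.$$ $f$ is called $\alpha$-differentiable at $t$ if this (finite) limit exists. *)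

theory Defs
  imports "HOL-Analysis.Analysis"
begin

definition mittag_leffler :: "real \<Rightarrow> real \<Rightarrow> real" where
  "mittag_leffler \<beta> x = (\<Sum>k. x ^ k / Gamma (\<beta> * real k + 1))"

definition has_local_M_deriv ::
    "real \<Rightarrow> real \<Rightarrow> (real \<Rightarrow> real) \<Rightarrow> real \<Rightarrow> real \<Rightarrow> bool" where
  "has_local_M_deriv \<alpha> \<beta> f t D \<longleftrightarrow>
     ((\<lambda>\<epsilon>. (f (t * mittag_leffler \<beta> (\<epsilon> * t powr (- \<alpha>))) - f t) / \<epsilon>) \<longlongrightarrow> D) (at 0)"

definition local_M_differentiable :: "real \<Rightarrow> real \<Rightarrow> (real \<Rightarrow> real) \<Rightarrow> real \<Rightarrow> bool" where
  "local_M_differentiable \<alpha> \<beta> f t \<longleftrightarrow> (\<exists>D. has_local_M_deriv \<alpha> \<beta> f t D)"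

(* The value is meaningful only where f is local_M_differentiable; elsewhere it is unspecified. *)
definition local_M_deriv :: "real \<Rightarrow> real \<Rightarrow> (real \<Rightarrow> real) \<Rightarrow> real \<Rightarrow> real" where
  "local_M_deriv \<alpha> \<beta> f t = (THE D. has_local_M_deriv \<alpha> \<beta> f t D)"

end

theory Submission
  imports Defs
begin

text \<open>
  As in the classical Rolle theorem, \<open>f\<close> has an interior extremum \<open>c\<close>. The Mittag-Leffler function
  is continuous at \<open>0\<close> with value \<open>1\<close>, so the points at which the difference quotient evaluates
  \<open>f\<close> stay in \<open>(a, b)\<close> for small \<open>\<epsilon>\<close>. Hence the numerator has constant sign near \<open>0\<close>, the quotient
  changes sign with \<open>\<epsilon>\<close>, and the two-sided limit vanishes. Only continuity of the Mittag-Leffler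
  function at \<open>0\<close> matters, not its derivative.
\<close>

text \<open>Serves to bound the coefficients of the Mittag-Leffler series uniformly in the index.
  Compactness gives a positive minimum on [1, 2], and the recurrence Gamma x = (x - 1) Gamma (x - 1)
  carries it to the right, since the factor is at least 1 once x \<ge> 2.\<close>

lemma Gamma_real_lower_bound:
  obtains m :: real where "0 < m" "\<And>x. 1 \<le> x \<Longrightarrow> m \<le> Gamma x"
proof -
  have "continuous_on {1..2::real} Gamma"
    by (rule continuous_on_Gamma) (auto elim!: nonpos_Ints_cases)
  then obtain y :: real where y: "y \<in> {1..2}" "\<forall>x\<in>{1..2}. Gamma y \<le> Gamma x"
    using continuous_attains_inf[of "{1..2::real}" Gamma] by auto
  \<comment> \<open>The reals x \<ge> 1 are exhausted by the intervals [1, n + 2], so that induction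
    on n can descend from x to x - 1.\<close>
  have bound: "Gamma y \<le> Gamma x" if "1 \<le> x" "x \<le> real n + 2" for n and x :: real
    using that
  proof (induction n arbitrary: x)
    case 0
    then show ?case using y by simp
  next
    case (Suc n)
    show ?case
    proof (cases "x \<le> 2")
      case True
      then show ?thesis using Suc.prems y by simp
    next
      case False
      have "Gamma y \<le> Gamma (x - 1)"
        using Suc False by simp
      also have "\<dots> \<le> (x - 1) * Gamma (x - 1)"
        using False Gamma_real_pos[of "x - 1"] by simp
      also have "\<dots> = Gamma x"
        using Gamma_plus1[of "x - 1"] nonpos_Ints_nonpos[of "x - 1"] False by fastforce
      finally show ?thesis .
    qed
  qed
  show thesis
  proof
    show "0 < Gamma y" using y by (intro Gamma_real_pos) auto
    show "Gamma y \<le> Gamma x" if "1 \<le> x" for x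
    proof -
      obtain n where "x \<le> real n" using real_arch_simple by blast
      then show ?thesis using bound[of x n] that by simp
    qed
  qed
qed

lemma mittag_leffler_0 [simp]: "mittag_leffler \<beta> 0 = 1"
  unfolding mittag_leffler_def
  using powser_zero[of "\<lambda>k. 1 / Gamma (\<beta> * real k + 1)"] by simp

text \<open>For \<beta> > 0 every Gamma argument is at least 1, so all coefficients lie in (0, 1/m].
  Comparison with a geometric series then gives a positive radius of convergence, inside which a
  power series is continuous.\<close>

lemma isCont_mittag_leffler_0:
  assumes "0 < \<beta>"
  shows "isCont (mittag_leffler \<beta>) 0"
proof -
  obtain m :: real where m: "0 < m" "\<And>x. 1 \<le> x \<Longrightarrow> m \<le> Gamma x"
    using Gamma_real_lower_bound by blast
  \<comment> \<open>Any nonzero point of (-1, 1) would do in place of 1/2: continuity at 0 only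
    requires convergence at some point away from 0.\<close>
  have "summable (\<lambda>k. 1 / Gamma (\<beta> * real k + 1) * (1/2) ^ k)"
  proof (rule summable_comparison_test')
    show "summable (\<lambda>k. 1 / m * (1/2) ^ k)"
      by (intro summable_mult summable_geometric) simp
    fix k :: nat
    have "m \<le> Gamma (\<beta> * real k + 1)"
      using assms by (intro m(2)) simp
    then show "norm (1 / Gamma (\<beta> * real k + 1) * (1/2) ^ k) \<le> 1 / m * (1/2) ^ k"
      using m(1) by (simp add: abs_mult frac_le)
  qed
  from isCont_powser[OF this, of 0]
  have "isCont (\<lambda>x. \<Sum>k. 1 / Gamma (\<beta> * real k + 1) * x ^ k) 0"
    by simp
  then show ?thesis
    by (simp add: mittag_leffler_def[abs_def])
qed

text \<open>Reduces the case of a minimum to that of a maximum.\<close>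

lemma has_local_M_deriv_minus:
  assumes "has_local_M_deriv \<alpha> \<beta> f t D"
  shows "has_local_M_deriv \<alpha> \<beta> (\<lambda>x. - f x) t (- D)"
proof -
  have "((\<lambda>\<epsilon>. - ((f (t * mittag_leffler \<beta> (\<epsilon> * t powr (- \<alpha>))) - f t) / \<epsilon>)) \<longlongrightarrow> - D) (at 0)"
    using assms unfolding has_local_M_deriv_def by (rule tendsto_minus)
  then show ?thesis
    unfolding has_local_M_deriv_def by (simp add: minus_divide_left)
qed

lemma local_M_deriv_eqI:
  assumes "has_local_M_deriv \<alpha> \<beta> f t D"
  shows "local_M_deriv \<alpha> \<beta> f t = D"
  unfolding local_M_deriv_def
  using assms by (rule the_equality)
    (use assms in \<open>auto simp: has_local_M_deriv_def intro: tendsto_unique[OF at_neq_bot]\<close>)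

lemma has_local_M_deriv_local_max:
  assumes "0 < \<beta>" and D: "has_local_M_deriv \<alpha> \<beta> f t D"
    and max: "\<forall>\<^sub>F x in nhds t. f x \<le> f t"
  shows "D = 0"
proof -
  define g where "g \<epsilon> = t * mittag_leffler \<beta> (\<epsilon> * t powr (- \<alpha>))" for \<epsilon>
  have "isCont (\<lambda>\<epsilon>. mittag_leffler \<beta> (\<epsilon> * t powr (- \<alpha>))) 0"
    by (rule isCont_o2[where g = "mittag_leffler \<beta>"])
      (use isCont_mittag_leffler_0[OF \<open>0 < \<beta>\<close>] in auto)
  then have "isCont g 0"
    unfolding g_def by (intro continuous_intros)
  \<comment> \<open>The target is \<open>nhds t\<close>, not \<open>at t\<close>: the inequality of
    a maximum also holds at t itself, so it need not be shown that \<open>g \<epsilon>\<close>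
    avoids t for \<epsilon> \<noteq> 0.\<close>
  then have "filterlim g (nhds t) (at 0)"
    by (simp add: isCont_def g_def)
  with max have ev: "\<forall>\<^sub>F \<epsilon> in at 0. f (g \<epsilon>) \<le> f t"
    by (rule eventually_compose_filterlim)
  have lim: "((\<lambda>\<epsilon>. (f (g \<epsilon>) - f t) / \<epsilon>) \<longlongrightarrow> D) (at 0)"
    using D by (simp add: has_local_M_deriv_def g_def)
  have "D \<le> 0"
  proof (rule tendsto_upperbound)
    show "((\<lambda>\<epsilon>. (f (g \<epsilon>) - f t) / \<epsilon>) \<longlongrightarrow> D) (at_right 0)"
      using lim by (simp add: filterlim_at_split)
    have "\<forall>\<^sub>F \<epsilon> in at_right 0. f (g \<epsilon>) \<le> f t"
      using ev by (simp add: eventually_at_split)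
    then show "\<forall>\<^sub>F \<epsilon> in at_right 0. (f (g \<epsilon>) - f t) / \<epsilon> \<le> 0"
      using eventually_at_right_less[of 0]
      by eventually_elim (simp add: divide_nonpos_pos)
  qed simp
  moreover have "0 \<le> D"
  proof (rule tendsto_lowerbound)
    show "((\<lambda>\<epsilon>. (f (g \<epsilon>) - f t) / \<epsilon>) \<longlongrightarrow> D) (at_left 0)"
      using lim by (simp add: filterlim_at_split)
    have "\<forall>\<^sub>F \<epsilon> in at_left 0. f (g \<epsilon>) \<le> f t"
      using ev by (simp add: eventually_at_split)
    moreover have "\<forall>\<^sub>F \<epsilon> in at_left (0::real). \<epsilon> < 0"
      by (simp add: eventually_at_filter)
    ultimately show "\<forall>\<^sub>F \<epsilon> in at_left 0. 0 \<le> (f (g \<epsilon>) - f t) / \<epsilon>"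
      by eventually_elim (simp add: divide_nonpos_neg)
  qed simp
  ultimately show ?thesis by simp
qed

lemma interior_extremum:
  fixes f :: "real \<Rightarrow> real"
  assumes "a < b" and "continuous_on {a..b} f" and "f a = f b"
  obtains c where "c \<in> {a<..<b}"
    and "(\<forall>x\<in>{a..b}. f x \<le> f c) \<or> (\<forall>x\<in>{a..b}. f c \<le> f x)"
proof -
  obtain u where u: "u \<in> {a..b}" "\<forall>x\<in>{a..b}. f x \<le> f u"
    using continuous_attains_sup[of "{a..b}" f] assms by auto
  obtain l where l: "l \<in> {a..b}" "\<forall>x\<in>{a..b}. f l \<le> f x"
    using continuous_attains_inf[of "{a..b}" f] assms by auto
  consider "u \<in> {a<..<b}" | "l \<in> {a<..<b}" | "u \<in> {a, b}" "l \<in> {a, b}"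
    using u(1) l(1) by fastforce
  then show thesis
  proof cases
    \<comment> \<open>Maximum and minimum both equal the common endpoint value, so f is constant and
      any interior point serves; the midpoint is taken.\<close>
    case 3
    then have "f u = f a" "f l = f a" using assms(3) by auto
    moreover have mid: "(a + b) / 2 \<in> {a<..<b}"
      using assms(1) by simp
    then have "f l \<le> f ((a + b) / 2)"
      using l(2) by simp
    ultimately have "\<forall>x\<in>{a..b}. f x \<le> f ((a + b) / 2)"
      using u(2) by fastforce
    then show thesis using that mid by blast
  qed (use that u l in blast)+
qed

theorem theorem5:
  fixes a b \<alpha> \<beta> :: real and f :: "real \<Rightarrow> real"
  assumes "0 < a" and "a < b" and "0 < \<beta>"
    and "continuous_on {a..b} f"
    and "0 < \<alpha>" and "\<alpha> < 1"
    and "\<forall>t\<in>{a<..<b}. local_M_differentiable \<alpha> \<beta> f t"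
    and "f a = f b"
  shows "\<exists>c\<in>{a<..<b}. local_M_deriv \<alpha> \<beta> f c = 0"
proof -
  obtain c where c: "c \<in> {a<..<b}"
    and ext: "(\<forall>x\<in>{a..b}. f x \<le> f c) \<or> (\<forall>x\<in>{a..b}. f c \<le> f x)"
    using interior_extremum[OF assms(2,4,8)] by blast
  obtain D where D: "has_local_M_deriv \<alpha> \<beta> f c D"
    using assms(7) c unfolding local_M_differentiable_def by blast
  \<comment> \<open>Since c is interior, an extremum over [a, b] is also a local one on both sides
    of c.\<close>
  have near: "\<forall>\<^sub>F x in nhds c. x \<in> {a<..<b}"
    using c by (intro eventually_nhds_in_open) auto
  have "D = 0"
    using ext
  proof
    assume "\<forall>x\<in>{a..b}. f x \<le> f c"
    then have "\<forall>\<^sub>F x in nhds c. f x \<le> f c"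
      by (intro eventually_mono[OF near]) auto
    then show ?thesis
      by (rule has_local_M_deriv_local_max[OF assms(3) D])
  next
    assume "\<forall>x\<in>{a..b}. f c \<le> f x"
    then have "\<forall>\<^sub>F x in nhds c. - f x \<le> - f c"
      by (intro eventually_mono[OF near]) auto
    then have "- D = 0"
      by (rule has_local_M_deriv_local_max[OF assms(3) has_local_M_deriv_minus[OF D]])
    then show ?thesis by simp
  qed
  then show ?thesis
    using local_M_deriv_eqI[OF D] c by blast
qed

end
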